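(* Let $n,m$ be positive integers. If at least one of $n$ and $m$ is odd, then the first player wins the Peaceable Queens Game $\mathrm{PQ}(n,m)$.
   Context: The Peaceable Queens Game $\mathrm{PQ}(n,m)$ is played on an $n\times m$ chessboard with squares $(x,y)$, $0\leq x\leq n-1$, $0\leq y\leq m-1$. Two players alternately place a queen on an unoccupied square; the first player places white queens and the second player places black queens. A player may not place a queen on a square within attacking range of a queen previously placed by the opponent. A player unable to move on their turn loses. Two distinct squares $(x_1,y_1)$ and $(x_2,y_2)$ are within attacking range for queens iff $x_1=x_2$, or $y_1=y_2$, or $|x_1-x_2|=|y_1-y_2|$ (regardless of any pieces standing between them). A player "wins" the game if that player has a winning strategy. *)

theory Defs
  imports Main
begin

type_synonym square = "nat \<times> nat"

datatype player = White | Black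

definition board :: "nat \<Rightarrow> nat \<Rightarrow> square set" where
  "board n m = {0..<n} \<times> {0..<m}"

definition attacks :: "square \<Rightarrow> square \<Rightarrow> bool" where
  "attacks p q \<longleftrightarrow> p \<noteq> q \<and>
     (fst p = fst q \<or> snd p = snd q \<or>
      \<bar>int (fst p) - int (fst q)\<bar> = \<bar>int (snd p) - int (snd q)\<bar>)"

text \<open>
  A game record is the list of occupied squares in the order of play: the moves with even index
  (counting from 0) are White's, those with odd index are Black's.
\<close>

definition mover :: "nat \<Rightarrow> player" where
  "mover i = (if even i then White else Black)"

definition to_move :: "square list \<Rightarrow> player" where
  "to_move h = mover (length h)"

definition queens :: "player \<Rightarrow> square list \<Rightarrow> square set" where
  "queens P h = {h ! i | i. i < length h \<and> mover i = P}"

definition legal :: "nat \<Rightarrow> nat \<Rightarrow> square list \<Rightarrow> square \<Rightarrow> bool" where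
  "legal n m h s \<longleftrightarrow> s \<in> board n m \<and> s \<notin> set h \<and>
     (\<forall>P. P \<noteq> to_move h \<longrightarrow> (\<forall>t \<in> queens P h. \<not> attacks s t))"

inductive play :: "nat \<Rightarrow> nat \<Rightarrow> square list \<Rightarrow> bool" for n m where
  start: "play n m []"
| move: "play n m h \<Longrightarrow> legal n m h s \<Longrightarrow> play n m (h @ [s])"

definition finished :: "nat \<Rightarrow> nat \<Rightarrow> square list \<Rightarrow> bool" where
  "finished n m h \<longleftrightarrow> play n m h \<and> (\<nexists>s. legal n m h s)"

text \<open>
  A strategy maps a game record to the player's next square. Its values matter only at records
  where it is the player's turn and a move is available.
\<close>

definition strategy :: "nat \<Rightarrow> nat \<Rightarrow> player \<Rightarrow> (square list \<Rightarrow> square) \<Rightarrow> bool" where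
  "strategy n m P \<sigma> \<longleftrightarrow>
     (\<forall>h. play n m h \<longrightarrow> to_move h = P \<longrightarrow> (\<exists>s. legal n m h s) \<longrightarrow> legal n m h (\<sigma> h))"

definition follows :: "player \<Rightarrow> (square list \<Rightarrow> square) \<Rightarrow> square list \<Rightarrow> bool" where
  "follows P \<sigma> h \<longleftrightarrow> (\<forall>i < length h. mover i = P \<longrightarrow> h ! i = \<sigma> (take i h))"

text \<open>
  The player to move at the end of a finished game has lost. Quantifying over finished games
  suffices because there are no infinite games: see \<open>play_bounded\<close> below.
\<close>

definition winning_strategy :: "nat \<Rightarrow> nat \<Rightarrow> player \<Rightarrow> (square list \<Rightarrow> square) \<Rightarrow> bool" where
  "winning_strategy n m P \<sigma> \<longleftrightarrow> strategy n m P \<sigma> \<and>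
     (\<forall>h. finished n m h \<longrightarrow> follows P \<sigma> h \<longrightarrow> to_move h \<noteq> P)"

definition wins :: "nat \<Rightarrow> nat \<Rightarrow> player \<Rightarrow> bool" where
  "wins n m P \<longleftrightarrow> (\<exists>\<sigma>. winning_strategy n m P \<sigma>)"

lemma play_distinct_board: "play n m h \<Longrightarrow> distinct h \<and> set h \<subseteq> board n m"
  by (induction rule: play.induct) (auto simp: legal_def)

lemma play_bounded:
  assumes "play n m h"
  shows "length h \<le> n * m"
proof -
  have "card (set h) \<le> card (board n m)"
    using play_distinct_board[OF assms] by (intro card_mono) (auto simp: board_def)
  then show ?thesis
    using play_distinct_board[OF assms] by (simp add: distinct_card board_def)
qed

end

theory Submission
  imports Defs
begin

text \<open>
  White opens at the centre of the board (as nearly as parity allows) and from then on answers each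
  black queen with its image under the rotation of the board by a half turn. Since one side of the
  board is odd, a square that is attacked by, or equal to, its own image lies on a line through
  the opening square, so Black can never use it; every other obstruction to White's answer would,
  by symmetry, already have been an obstruction to the move of Black that it answers.
\<close>

definition half_turn :: "nat \<Rightarrow> nat \<Rightarrow> square \<Rightarrow> square" where
  "half_turn n m p = (n - 1 - fst p, m - 1 - snd p)"

text \<open>For an even side this takes the larger of the two middle coordinates, which the half
  turn swaps; the middle line of an odd side is fixed.\<close>

definition centre :: "nat \<Rightarrow> nat \<Rightarrow> square" where
  "centre n m = (n div 2, m div 2)"

lemma half_turn_in_board: "p \<in> board n m \<Longrightarrow> half_turn n m p \<in> board n m"
  by (auto simp: board_def half_turn_def)

lemma half_turn_half_turn: "p \<in> board n m \<Longrightarrow> half_turn n m (half_turn n m p) = p"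
  by (auto simp: board_def half_turn_def)

text \<open>The half turn is an involution preserving lines and diagonals, so it can be moved from
  one argument to the other.\<close>

lemma attacks_half_turn_left:
  assumes "p \<in> board n m" "q \<in> board n m"
  shows "attacks (half_turn n m p) q \<longleftrightarrow> attacks p (half_turn n m q)"
proof -
  obtain x y u v where pq: "p = (x, y)" "q = (u, v)"
    by (cases p, cases q) auto
  have lt: "x < n" "y < m" "u < n" "v < m"
    using assms pq by (auto simp: board_def)
  have "n - 1 - x = u \<longleftrightarrow> x = n - 1 - u" "m - 1 - y = v \<longleftrightarrow> y = m - 1 - v"
    using lt by auto
  moreover have "\<bar>int (n - 1 - x) - int u\<bar> = \<bar>int x - int (n - 1 - u)\<bar>"
    "\<bar>int (m - 1 - y) - int v\<bar> = \<bar>int y - int (m - 1 - v)\<bar>"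
    using lt by (simp_all add: of_nat_diff)
  ultimately show ?thesis
    by (simp add: attacks_def half_turn_def pq)
qed

lemma half_turn_safe:
  assumes "odd n \<or> odd m" "p \<in> board n m" "p \<noteq> centre n m" "\<not> attacks p (centre n m)"
  shows "\<not> attacks (half_turn n m p) p" "half_turn n m p \<noteq> p" "half_turn n m p \<noteq> centre n m"
proof -
  obtain x y where p: "p = (x, y)"
    by (cases p)
  have lt: "x < n" "y < m"
    using assms(2) p by (auto simp: board_def)
  have ne: "x \<noteq> n div 2" "y \<noteq> m div 2"
    "\<bar>int x - int (n div 2)\<bar> \<noteq> \<bar>int y - int (m div 2)\<bar>"
    using assms(3,4) by (auto simp: p attacks_def centre_def)
  have x: "n - 1 - x \<noteq> x"
    using ne(1) lt by presburger
  have y: "m - 1 - y \<noteq> y"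
    using ne(2) lt by presburger
  have d: "\<bar>int (n - 1 - x) - int x\<bar> \<noteq> \<bar>int (m - 1 - y) - int y\<bar>"
  proof
    assume eq: "\<bar>int (n - 1 - x) - int x\<bar> = \<bar>int (m - 1 - y) - int y\<bar>"
    have "int (n - 1 - x) = int n - 1 - int x" "int (m - 1 - y) = int m - 1 - int y"
      using lt by auto
    with eq have eq': "int n - 1 - 2 * int x = int m - 1 - 2 * int y
        \<or> int n - 1 - 2 * int x = - (int m - 1 - 2 * int y)"
      by linarith
    \<comment> \<open>The offsets have the parities of \<open>n - 1\<close> and
      \<open>m - 1\<close>, so agreement up to sign makes both sides odd. The centre is then fixed
      by the half turn, and halving the offsets puts \<open>p\<close> on a diagonal through
      it.\<close>
    then have "even (int n) \<longleftrightarrow> even (int m)"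
      by presburger
    with assms(1) have "odd n" "odd m"
      by auto
    then obtain k l where "n = 2 * k + 1" "m = 2 * l + 1"
      by (auto elim!: oddE)
    with eq' ne(3) show False
      by auto
  qed
  show "\<not> attacks (half_turn n m p) p" "half_turn n m p \<noteq> p"
    using x y d by (auto simp: p attacks_def half_turn_def)
  show "half_turn n m p \<noteq> centre n m"
  proof
    assume "half_turn n m p = centre n m"
    then have "n - 1 - x = n div 2" "m - 1 - y = m div 2"
      by (auto simp: p half_turn_def centre_def)
    \<comment> \<open>Off the centre's column, \<open>x\<close> must be the other middle coordinate,
      which exists only for even \<open>n\<close>; likewise for \<open>y\<close> and
      \<open>m\<close>.\<close>
    with lt have "n = n div 2 + 1 + x" "m = m div 2 + 1 + y"
      by linarith+
    with ne(1,2) have "even n" "even m"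
      by presburger+
    with assms(1) show False
      by simp
  qed
qed

lemma play_nth_in_board: "play n m h \<Longrightarrow> i < length h \<Longrightarrow> h ! i \<in> board n m"
  using play_distinct_board nth_mem by blast

text \<open>Odd \<open>i + j\<close> means opposite colours; the later queen's legality gives the
  claim.\<close>

lemma play_not_attacks:
  assumes "play n m h" "i < j" "j < length h" "odd (i + j)"
  shows "\<not> attacks (h ! j) (h ! i)"
  using assms
proof (induction rule: play.induct)
  case (move h s)
  show ?case
  proof (cases "j = length h")
    case True
    have "h ! i \<in> queens (mover i) h" "mover i \<noteq> to_move h"
      using move.prems True by (auto simp: queens_def to_move_def mover_def)
    with move.hyps(2) have "\<not> attacks s (h ! i)"
      by (auto simp: legal_def)
    with True move.prems show ?thesis
      by (simp add: nth_append)
  qed (use move in \<open>auto simp: nth_append\<close>)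
qed simp

text \<open>Only White's entries are constrained, so any black move preserves this
  invariant.\<close>

definition mirrored :: "nat \<Rightarrow> nat \<Rightarrow> square list \<Rightarrow> bool" where
  "mirrored n m h \<longleftrightarrow> (\<forall>i < length h. even i \<longrightarrow>
     h ! i = (if i = 0 then centre n m else half_turn n m (h ! (i - 1))))"

definition reply :: "nat \<Rightarrow> nat \<Rightarrow> square list \<Rightarrow> square" where
  "reply n m h = (if h = [] then centre n m else half_turn n m (last h))"

lemma legal_reply:
  assumes "n > 0" "m > 0" "odd n \<or> odd m" and play: "play n m h"
    and mir: "mirrored n m h" and "even (length h)"
  shows "legal n m h (reply n m h)"
proof (cases "h = []")
  case True
  with assms(1,2) show ?thesis
    by (simp add: legal_def reply_def board_def centre_def queens_def)
next
  case False
  \<comment> \<open>\<open>L\<close> is the index of Black's latest queen \<open>p\<close>, the one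
    to be answered.\<close>
  define L where "L = length h - 1"
  define p where "p = h ! L"
  have L: "odd L" "length h = Suc L"
    using False assms(6) unfolding L_def by (cases h; simp)+
  have reply: "reply n m h = half_turn n m p"
    using False by (simp add: reply_def p_def L_def last_conv_nth)
  note dist = play_distinct_board[OF play]
  have board: "h ! i \<in> board n m" if "i \<le> L" for i
    using play_nth_in_board[OF play] that L by auto
  have p: "p \<in> board n m"
    using board by (simp add: p_def)
  have new: "p \<noteq> h ! i" if "i < L" for i
    using dist that L by (simp add: p_def nth_eq_iff_index_eq)
  have peace: "\<not> attacks p (h ! i)" if "i < L" "even i" for i
    using play_not_attacks[OF play, of i L] that L by (simp add: p_def)
  have "0 < L"
    using L by (simp add: odd_pos)
  have h0: "h ! 0 = centre n m"
    using mir L unfolding mirrored_def by auto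
  have answer: "h ! Suc i = half_turn n m (h ! i)" if "i < L" "odd i" for i
    using mir that L unfolding mirrored_def by auto
  \<comment> \<open>As \<open>L\<close> is odd, White's answer to an earlier black move also
    precedes \<open>p\<close>.\<close>
  have odd_step: "Suc i < L" if "i < L" "odd i" for i
    using that L by (metis Suc_lessI even_Suc)
  have safe: "\<not> attacks (half_turn n m p) p" "half_turn n m p \<noteq> p" "half_turn n m p \<noteq> centre n m"
    using half_turn_safe[OF assms(3) p] new[OF \<open>0 < L\<close>] peace[OF \<open>0 < L\<close>] h0 by auto
  \<comment> \<open>If the image of \<open>p\<close> were occupied, the mirror partner of that queen
    would already stand on \<open>p\<close>: the preceding black queen for even \<open>i\<close>,
    White's answer for odd \<open>i\<close>. The opening queen and \<open>p\<close> itself are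
    excluded by \<open>safe\<close>.\<close>
  have "half_turn n m p \<noteq> h ! i" if "i \<le> L" for i
  proof
    assume eq: "half_turn n m p = h ! i"
    then have i: "i < L" "0 < i"
      using that safe h0 by (auto simp: p_def order_le_less intro: gr0I)
    have p_eq: "p = half_turn n m (h ! i)"
      using eq half_turn_half_turn[OF p] by simp
    show False
    proof (cases "even i")
      case True
      with i obtain j where j: "i = Suc j" "odd j" "j < L"
        by (cases i) auto
      then have "p = h ! j"
        using p_eq answer half_turn_half_turn[OF board] by auto
      with new j show False by blast
    next
      case False
      with p_eq answer i have "p = h ! Suc i" by simp
      with new odd_step i False show False by blast
    qed
  qed
  then have "half_turn n m p \<notin> set h"
    using L by (metis in_set_conv_nth less_Suc_eq_le)
  \<comment> \<open>For an earlier black queen, symmetry turns the attack into one between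
    \<open>p\<close> and White's answer to that queen.\<close>
  moreover have "\<not> attacks (half_turn n m p) (h ! i)" if "i \<le> L" "odd i" for i
  proof (cases "i = L")
    case True
    with safe show ?thesis by (simp add: p_def)
  next
    case False
    with that have i: "i < L" by simp
    show ?thesis
      using peace[OF odd_step[OF i that(2)]] that answer[OF i that(2)]
        attacks_half_turn_left[OF p board[OF that(1)]] by simp
  qed
  ultimately show ?thesis
    using half_turn_in_board[OF p] L
    by (auto simp: reply legal_def to_move_def mover_def queens_def split: if_splits)
qed

text \<open>
  A strategy must be legal at every record, also at those which mirroring play never reaches;
  there any legal move is chosen.
\<close>

definition mirror_strategy :: "nat \<Rightarrow> nat \<Rightarrow> square list \<Rightarrow> square" where
  "mirror_strategy n m h =
     (if legal n m h (reply n m h) then reply n m h else (SOME s. legal n m h s))"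

lemma strategy_mirror_strategy: "strategy n m P (mirror_strategy n m)"
  by (auto simp: strategy_def mirror_strategy_def intro: someI)

text \<open>The reply is known to be legal only at mirrored records, so the induction hypothesis is
  what rules out the arbitrary choice in \<open>mirror_strategy\<close>.\<close>

lemma mirrored_if_follows:
  assumes "play n m h" "n > 0" "m > 0" "odd n \<or> odd m"
    and "follows White (mirror_strategy n m) h"
  shows "mirrored n m h"
  using assms(1,5)
proof (induction rule: play.induct)
  case start
  show ?case by (simp add: mirrored_def)
next
  case (move h s)
  have "follows White (mirror_strategy n m) h"
    unfolding follows_def
  proof (intro allI impI)
    fix i assume "i < length h" "mover i = White"
    with move.prems[unfolded follows_def, rule_format, of i]
    show "h ! i = mirror_strategy n m (take i h)"
      by (simp add: nth_append)
  qed
  then have mir: "mirrored n m h"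
    by (rule move.IH)
  have "s = reply n m h" if "even (length h)"
  proof -
    have "s = mirror_strategy n m h"
      using move.prems[unfolded follows_def, rule_format, of "length h"] that
      by (simp add: mover_def)
    with legal_reply[OF assms(2-4) move.hyps(1) mir that] show ?thesis
      by (simp add: mirror_strategy_def)
  qed
  with mir show ?case
    by (auto simp: mirrored_def nth_append reply_def last_conv_nth less_Suc_eq)
qed

theorem theorem5p5:
  fixes n m :: nat
  assumes "n > 0" and "m > 0"
    and "odd n \<or> odd m"
  shows "wins n m White"
proof -
  have "to_move h \<noteq> White"
    if "finished n m h" "follows White (mirror_strategy n m) h" for h
  proof
    assume "to_move h = White"
    then have "even (length h)"
      by (simp add: to_move_def mover_def split: if_splits)
    moreover have "play n m h"
      using that by (simp add: finished_def)
    ultimately have "legal n m h (reply n m h)"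
      using legal_reply mirrored_if_follows assms that(2) by blast
    with that(1) show False
      unfolding finished_def by blast
  qed
  then show ?thesis
    unfolding wins_def winning_strategy_def using strategy_mirror_strategy by blast
qed

end
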